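(* Let $N\ge 1$, let $\Phi:\mathbb{R}^N\to\mathbb{R}$ be a potential, and consider the mean-field underdamped Langevin dynamics for $z=(q^\top,p^\top)^\top\in\mathbb{R}^{2N}$, $$\frac{\mathrm{d} z}{\mathrm{d} t}=\mathcal{J}\, D\mathcal{H}(z)-\mathcal{K}\, D\mathcal{H}(z)+\sqrt{2\mathcal{K}}\,\frac{\mathrm{d} W_0}{\mathrm{d} t},\qquad \mathcal{J}=\begin{pmatrix}0&\mathcal{C}\\-\mathcal{C}&0\end{pmatrix},\quad \mathcal{K}=\begin{pmatrix}\mathcal{K}_1&0\\0&\mathcal{K}_2\end{pmatrix},$$ where $\mathcal{H}(z)=\frac12\langle p,\mathcal{M}^{-1}p\rangle+\Phi(q)$ and $W_0$ is a standard Brownian motion in $\mathbb{R}^{2N}$. Assume that the $N\times N$ matrices $\mathcal{K}_1,\mathcal{K}_2$ are symmetric and non-negative definite, and that the $N\times N$ matrix $\mathcal{C}$ is symmetric positive definite. Assume further that $\mathcal{C}$, $\mathcal{K}$ and $\mathcal{M}$ may depend on the law of $z$ under these dynamics but are independent of $z$ itself (all their derivatives with respect to $z$ are zero). Then the Gibbs measure with density $$\Pi(z)=\frac{1}{Z_{q,p}}\exp(-\mathcal{H}(z))$$ is invariant under these dynamics.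
   Context: $D$ (or $\nabla$) is the gradient in the argument displayed. $\Phi$ is assumed smooth enough for the gradient to make sense, with $e^{-\Phi}$ integrable; $\mathcal{M}$ is a symmetric positive definite $N\times N$ matrix (the mass matrix), and $Z_{q,p}$ is the normalization constant making $\Pi$ a probability density on $\mathbb{R}^{2N}$. The matrices are functions of the current law $\rho$ of $z(t)$: $\mathcal{C}=\mathcal{C}(\rho)$, $\mathcal{K}=\mathcal{K}(\rho)$, $\mathcal{M}=\mathcal{M}(\rho)$, hence $\mathcal{J}=\mathcal{J}(\rho)$ and $\mathcal{H}=\mathcal{H}_\rho$. The Gibbs density $\Pi$ is understood self-consistently: the matrix $\mathcal{M}$ in the formula for $\Pi$ is $\mathcal{M}$ evaluated at the law $\Pi$. The density $\rho(z,t)$ of the law of $z(t)$ evolves by the (nonlinear, nonlocal) Fokker--Planck equation of the SDE, $$\partial_t\rho=-\nabla\cdot\bigl(\rho\,(\mathcal{J}-\mathcal{K})\nabla\mathcal{H}\bigr)+\nabla\cdot\bigl(\mathcal{K}\nabla\rho\bigr),$$ with $\mathcal{J},\mathcal{K},\mathcal{H}$ evaluated at $\rho(\cdot,t)$. "Invariant" means that $\Pi$ is a stationary solution of this equation (in the sense of distributions if $\Phi$ is only once continuously differentiable). *)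

theory Defs
  imports "HOL-Analysis.Analysis"
begin

section \<open>Calculus on Euclidean spaces\<close>

text \<open>Class \<open>C\<^sup>k\<close> on the whole space: differentiable, with all directional derivatives of class
  \<open>C\<^sup>k\<^sup>-\<^sup>1\<close>. In finite dimension this is the usual notion.\<close>

primrec Ck :: "nat \<Rightarrow> ('a::euclidean_space \<Rightarrow> real) \<Rightarrow> bool" where
  "Ck 0 f \<longleftrightarrow> continuous_on UNIV f"
| "Ck (Suc k) f \<longleftrightarrow>
     (\<forall>x. f differentiable (at x)) \<and> (\<forall>v. Ck k (\<lambda>x. frechet_derivative f (at x) v))"

definition grad :: "('a::euclidean_space \<Rightarrow> real) \<Rightarrow> 'a \<Rightarrow> 'a" where
  "grad f x = (THE D. GDERIV f x :> D)"

definition divg :: "('a::euclidean_space \<Rightarrow> 'a) \<Rightarrow> 'a \<Rightarrow> real" where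
  "divg F x = (\<Sum>b\<in>Basis. frechet_derivative F (at x) b \<bullet> b)"

definition test_function :: "'a::euclidean_space set \<Rightarrow> ('a \<Rightarrow> real) \<Rightarrow> bool" where
  "test_function U \<phi> \<longleftrightarrow> (\<forall>k. Ck k \<phi>) \<and>
     compact (closure (support_on UNIV \<phi>)) \<and> closure (support_on UNIV \<phi>) \<subseteq> U"

section \<open>Matrices\<close>

definition sym_nonneg_definite :: "real^'n^'n \<Rightarrow> bool" where
  "sym_nonneg_definite A \<longleftrightarrow> transpose A = A \<and> (\<forall>x. 0 \<le> x \<bullet> (A *v x))"

definition sym_pos_definite :: "real^'n^'n \<Rightarrow> bool" where
  "sym_pos_definite A \<longleftrightarrow> transpose A = A \<and> (\<forall>x. x \<noteq> 0 \<longrightarrow> 0 < x \<bullet> (A *v x))"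

text \<open>Phase space \<open>\<real>\<^sup>2\<^sup>N\<close> is \<open>\<real>\<^sup>N \<times> \<real>\<^sup>N\<close> with points \<open>z = (q, p)\<close>; a \<open>2N \<times> 2N\<close> matrix given in
  \<open>N \<times> N\<close> blocks is applied to \<open>z\<close> blockwise.\<close>

type_synonym 'n phase = "(real^'n) \<times> (real^'n)"

definition block_mult ::
  "real^'n^'n \<Rightarrow> real^'n^'n \<Rightarrow> real^'n^'n \<Rightarrow> real^'n^'n \<Rightarrow> 'n phase \<Rightarrow> 'n phase" where
  "block_mult A11 A12 A21 A22 z =
     (A11 *v fst z + A12 *v snd z, A21 *v fst z + A22 *v snd z)"

definition Jmult :: "real^'n^'n \<Rightarrow> 'n phase \<Rightarrow> 'n phase" where
  "Jmult C = block_mult 0 C (- C) 0"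

definition Kmult :: "real^'n^'n \<Rightarrow> real^'n^'n \<Rightarrow> 'n phase \<Rightarrow> 'n phase" where
  "Kmult K1 K2 = block_mult K1 0 0 K2"

section \<open>The mean-field dynamics\<close>

definition hamiltonian :: "(real^'n \<Rightarrow> real) \<Rightarrow> real^'n^'n \<Rightarrow> 'n phase \<Rightarrow> real" where
  "hamiltonian \<Phi> M z = 1/2 * (snd z \<bullet> (matrix_inv M *v snd z)) + \<Phi> (fst z)"

definition gibbs_density :: "(real^'n \<Rightarrow> real) \<Rightarrow> real^'n^'n \<Rightarrow> 'n phase \<Rightarrow> real" where
  "gibbs_density \<Phi> M z =
     1 / (LINT w|lborel. exp (- hamiltonian \<Phi> M w)) * exp (- hamiltonian \<Phi> M z)"

definition law :: "('n::finite phase \<Rightarrow> real) \<Rightarrow> 'n phase measure" where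
  "law \<rho> = density lborel (\<lambda>z. ennreal (\<rho> z))"

definition probability_density :: "('n::finite phase \<Rightarrow> real) \<Rightarrow> bool" where
  "probability_density \<rho> \<longleftrightarrow>
     (\<forall>z. 0 \<le> \<rho> z) \<and> integrable lborel \<rho> \<and> (LINT z|lborel. \<rho> z) = 1"

text \<open>The matrices are functions of the law. \<open>drift\<close> is \<open>(\<J> - \<K>) \<nabla>\<H>\<close> with all matrices evaluated
  at \<open>\<mu>\<close>.\<close>

definition drift ::
  "('n::finite phase measure \<Rightarrow> real^'n^'n) \<Rightarrow> ('n phase measure \<Rightarrow> real^'n^'n) \<Rightarrow>
   ('n phase measure \<Rightarrow> real^'n^'n) \<Rightarrow> ('n phase measure \<Rightarrow> real^'n^'n) \<Rightarrow>
   (real^'n \<Rightarrow> real) \<Rightarrow> 'n phase measure \<Rightarrow> 'n phase \<Rightarrow> 'n phase" where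
  "drift C K1 K2 M \<Phi> \<mu> z =
     Jmult (C \<mu>) (grad (hamiltonian \<Phi> (M \<mu>)) z)
     - Kmult (K1 \<mu>) (K2 \<mu>) (grad (hamiltonian \<Phi> (M \<mu>)) z)"

text \<open>Solutions, for \<open>t > 0\<close>, of
  \<open>\<partial>\<^sub>t\<rho> = - \<nabla>\<cdot>(\<rho> (\<J> - \<K>) \<nabla>\<H>) + \<nabla>\<cdot>(\<K> \<nabla>\<rho>)\<close> with \<open>\<J>, \<K>, \<H>\<close> evaluated at the law of \<open>\<rho>(\<cdot>, t)\<close>. The
  differentiability and integrability clauses are needed because \<open>grad\<close>, \<open>divg\<close> and the Bochner
  integral are total functions.\<close>

definition fokker_planck_classical ::
  "('n::finite phase measure \<Rightarrow> real^'n^'n) \<Rightarrow> ('n phase measure \<Rightarrow> real^'n^'n) \<Rightarrow>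
   ('n phase measure \<Rightarrow> real^'n^'n) \<Rightarrow> ('n phase measure \<Rightarrow> real^'n^'n) \<Rightarrow>
   (real^'n \<Rightarrow> real) \<Rightarrow> (real \<Rightarrow> 'n phase \<Rightarrow> real) \<Rightarrow> bool" where
  "fokker_planck_classical C K1 K2 M \<Phi> \<rho> \<longleftrightarrow>
     (\<forall>t>0. probability_density (\<rho> t) \<and>
       (let \<mu> = law (\<rho> t);
            advection = (\<lambda>z. \<rho> t z *\<^sub>R drift C K1 K2 M \<Phi> \<mu> z);
            diffusion = (\<lambda>z. Kmult (K1 \<mu>) (K2 \<mu>) (grad (\<rho> t) z))
        in \<forall>z. hamiltonian \<Phi> (M \<mu>) differentiable (at z) \<and> \<rho> t differentiable (at z) \<and>
               advection differentiable (at z) \<and> diffusion differentiable (at z) \<and>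
               ((\<lambda>s. \<rho> s z) has_real_derivative - divg advection z + divg diffusion z) (at t)))"

text \<open>The distributional form: the equation is tested against \<open>\<phi> \<in> C\<^sub>c\<^sup>\<infinity>((0,\<infinity>) \<times> \<real>\<^sup>2\<^sup>N)\<close> and all
  derivatives of \<open>\<rho>\<close> are moved onto \<open>\<phi>\<close> (\<open>\<K>\<close> is symmetric).\<close>

definition fokker_planck_distributional ::
  "('n::finite phase measure \<Rightarrow> real^'n^'n) \<Rightarrow> ('n phase measure \<Rightarrow> real^'n^'n) \<Rightarrow>
   ('n phase measure \<Rightarrow> real^'n^'n) \<Rightarrow> ('n phase measure \<Rightarrow> real^'n^'n) \<Rightarrow>
   (real^'n \<Rightarrow> real) \<Rightarrow> (real \<Rightarrow> 'n phase \<Rightarrow> real) \<Rightarrow> bool" where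
  "fokker_planck_distributional C K1 K2 M \<Phi> \<rho> \<longleftrightarrow>
     (\<forall>t>0. probability_density (\<rho> t) \<and>
            (\<forall>z. hamiltonian \<Phi> (M (law (\<rho> t))) differentiable (at z))) \<and>
     (\<forall>\<phi>. test_function ({0<..} \<times> UNIV) \<phi> \<longrightarrow>
       (let time = (\<lambda>(t, z). \<rho> t z * deriv (\<lambda>s. \<phi> (s, z)) t);
            advection = (\<lambda>(t, z).
              (\<rho> t z *\<^sub>R drift C K1 K2 M \<Phi> (law (\<rho> t)) z) \<bullet> grad (\<lambda>w. \<phi> (t, w)) z);
            diffusion = (\<lambda>(t, z). \<rho> t z *
              divg (\<lambda>w. Kmult (K1 (law (\<rho> t))) (K2 (law (\<rho> t))) (grad (\<lambda>v. \<phi> (t, v)) w)) z)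
        in integrable lborel time \<and> integrable lborel advection \<and> integrable lborel diffusion \<and>
           - (LINT x|lborel. time x)
             = (LINT x|lborel. advection x) + (LINT x|lborel. diffusion x)))"

text \<open>A density is invariant if the constant curve at it solves the Fokker--Planck equation: in the
  sense of distributions, and also pointwise once the potential is \<open>C\<^sup>2\<close>, so that the divergences
  make classical sense.\<close>

definition invariant_density ::
  "('n::finite phase measure \<Rightarrow> real^'n^'n) \<Rightarrow> ('n phase measure \<Rightarrow> real^'n^'n) \<Rightarrow>
   ('n phase measure \<Rightarrow> real^'n^'n) \<Rightarrow> ('n phase measure \<Rightarrow> real^'n^'n) \<Rightarrow>
   (real^'n \<Rightarrow> real) \<Rightarrow> ('n phase \<Rightarrow> real) \<Rightarrow> bool" where
  "invariant_density C K1 K2 M \<Phi> \<pi> \<longleftrightarrow>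
     fokker_planck_distributional C K1 K2 M \<Phi> (\<lambda>t. \<pi>) \<and>
     (Ck 2 \<Phi> \<longrightarrow> fokker_planck_classical C K1 K2 M \<Phi> (\<lambda>t. \<pi>))"

end

theory Submission
  imports Defs "HOL-Probability.Distributions"
begin

text \<open>Since \<open>\<nabla>\<pi> = - \<pi> \<nabla>\<H>\<close>, the advective flux \<open>\<pi> (\<J> - \<K>) \<nabla>\<H>\<close> equals \<open>\<K>\<nabla>\<pi> - \<J>\<nabla>\<pi>\<close>, so its
  \<open>\<K>\<close>-part cancels against the diffusive flux. What remains is \<open>\<nabla>\<cdot>(\<J>\<nabla>\<pi>)\<close>, the trace of the
  skew matrix \<open>\<J>\<close> against a symmetric Hessian, which is zero. If \<open>\<pi>\<close> is only \<open>C\<^sup>1\<close>, the Hessian is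
  taken of the test function instead: the tested advection and diffusion terms add up to
  \<open>\<nabla>\<cdot>(\<pi> (\<J> + \<K>) \<nabla>\<phi>)\<close>, the divergence of a compactly supported \<open>C\<^sup>1\<close> field, whose integral
  vanishes.\<close>

section \<open>Functions of class \<open>C\<^sup>k\<close>\<close>

text \<open>The base point is the last argument, so that directional derivatives can be iterated as
  functions on the whole space.\<close>

abbreviation dir_deriv :: "('a::euclidean_space \<Rightarrow> real) \<Rightarrow> 'a \<Rightarrow> 'a \<Rightarrow> real" where
  "dir_deriv f v \<equiv> (\<lambda>x. frechet_derivative f (at x) v)"

lemma dir_deriv_eq: "(f has_derivative f') (at x) \<Longrightarrow> dir_deriv f v x = f' v"
  using frechet_derivative_at by metis

lemma has_derivative_dir_deriv:
  "f differentiable (at x) \<Longrightarrow> (f has_derivative (\<lambda>v. dir_deriv f v x)) (at x)"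
  by (simp add: frechet_derivative_works)

text \<open>Differentiability gives continuity at the bottom level; above it the claim descends to
  the directional derivatives. The product and chain rules rely on this, since they involve the
  undifferentiated functions as well.\<close>

lemma Ck_SucD: "Ck (Suc k) f \<Longrightarrow> Ck k f"
proof (induction k arbitrary: f)
  case 0
  then show ?case
    by (auto intro!: differentiable_imp_continuous_on simp: differentiable_on_def differentiable_at_withinI)
next
  case (Suc k)
  then show ?case by (metis Ck.simps(2))
qed

lemma Ck_imp_continuous: "Ck k f \<Longrightarrow> continuous_on S f"
proof (induction k)
  case (Suc k)
  then show ?case using Ck_SucD by blast
qed (auto intro: continuous_on_subset)

lemma Ck_differentiable: "Ck (Suc k) f \<Longrightarrow> f differentiable (at x)"
  by simp

lemma Ck_dir_deriv: "Ck (Suc k) f \<Longrightarrow> Ck k (dir_deriv f v)"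
  by simp

lemma Ck_const: "Ck k (\<lambda>_. c)"
  by (induction k arbitrary: c) auto

lemma Ck_add:
  assumes "Ck k f" "Ck k g"
  shows "Ck k (\<lambda>x. f x + g x)"
  using assms
proof (induction k arbitrary: f g)
  case 0
  then show ?case by (simp add: continuous_on_add)
next
  case (Suc k)
  have "dir_deriv (\<lambda>x. f x + g x) v = (\<lambda>x. dir_deriv f v x + dir_deriv g v x)" for v
    using Suc.prems by (intro ext dir_deriv_eq has_derivative_add has_derivative_dir_deriv) auto
  with Suc show ?case by (auto intro: differentiable_add)
qed

lemma Ck_mult:
  assumes "Ck k f" "Ck k g"
  shows "Ck k (\<lambda>x. f x * g x)"
  using assms
proof (induction k arbitrary: f g)
  case 0
  then show ?case by (simp add: continuous_on_mult)
next
  case (Suc k)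
  have "dir_deriv (\<lambda>x. f x * g x) v = (\<lambda>x. f x * dir_deriv g v x + dir_deriv f v x * g x)" for v
    using Suc.prems by (intro ext dir_deriv_eq has_derivative_mult has_derivative_dir_deriv) auto
  moreover have "Ck k (\<lambda>x. f x * dir_deriv g v x + dir_deriv f v x * g x)" for v
    using Suc.prems Ck_SucD[OF Suc.prems(1)] Ck_SucD[OF Suc.prems(2)] by (intro Ck_add Suc.IH) auto
  ultimately show ?case
    using Suc.prems by (auto intro: differentiable_mult)
qed

lemma Ck_sum: "(\<And>i. i \<in> I \<Longrightarrow> Ck k (f i)) \<Longrightarrow> Ck k (\<lambda>x. \<Sum>i\<in>I. f i x)"
  by (induction I rule: infinite_finite_induct) (auto intro: Ck_const Ck_add)

text \<open>A linear map is its own derivative at every point, so its directional derivatives are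
  constant.\<close>

lemma Ck_linear:
  assumes "linear f"
  shows "Ck k f"
proof (cases k)
  case 0
  then show ?thesis using assms by (simp add: linear_continuous_on linear_conv_bounded_linear)
next
  case (Suc j)
  have "(f has_derivative f) (at x)" for x
    using assms by (simp add: bounded_linear_imp_has_derivative linear_conv_bounded_linear)
  then have "dir_deriv f v = (\<lambda>_. f v)" "f differentiable (at x)" for v x
    using dir_deriv_eq differentiable_def by blast+
  then show ?thesis using Suc by (simp add: Ck_const)
qed

text \<open>By the chain rule, the derivative along \<open>v\<close> is the derivative of
  \<open>f\<close> along \<open>L v\<close>, again composed with \<open>L\<close>; the induction
  therefore generalizes over \<open>f\<close>.\<close>

lemma Ck_compose_linear:
  fixes L :: "'a::euclidean_space \<Rightarrow> 'b::euclidean_space"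
  assumes "Ck k f" and L: "linear L"
  shows "Ck k (\<lambda>x. f (L x))"
  using assms(1)
proof (induction k arbitrary: f)
  case 0
  have "continuous_on UNIV L"
    using L by (simp add: linear_continuous_on linear_conv_bounded_linear)
  then show ?case using 0 by (auto intro: continuous_on_compose2)
next
  case (Suc k)
  have "(L has_derivative L) (at x)" for x
    using L by (simp add: bounded_linear_imp_has_derivative linear_conv_bounded_linear)
  then have *: "((\<lambda>x. f (L x)) has_derivative (\<lambda>v. dir_deriv f (L v) (L x))) (at x)" for x
    by (rule has_derivative_compose) (use Suc.prems in \<open>auto intro: has_derivative_dir_deriv\<close>)
  then have "dir_deriv (\<lambda>x. f (L x)) v = (\<lambda>x. dir_deriv f (L v) (L x))" for v
    by (intro ext dir_deriv_eq)
  moreover have "Ck k (\<lambda>x. dir_deriv f (L v) (L x))" for v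
    by (rule Suc.IH) (use Suc.prems in auto)
  moreover have "(\<lambda>x. f (L x)) differentiable (at x)" for x
    using * differentiable_def by blast
  ultimately show ?case by simp
qed

text \<open>Differentiation reproduces \<open>exp (f x)\<close> with an extra factor one class
  lower, so the induction can keep \<open>f\<close> fixed.\<close>

lemma Ck_exp:
  assumes "Ck k f"
  shows "Ck k (\<lambda>x. exp (f x))"
  using assms
proof (induction k)
  case 0
  then show ?case by (simp add: continuous_on_exp)
next
  case (Suc k)
  have *: "((\<lambda>x. exp (f x)) has_derivative (\<lambda>v. exp (f x) * dir_deriv f v x)) (at x)" for x
    using Suc.prems by (auto intro!: derivative_eq_intros has_derivative_dir_deriv)
  then have "dir_deriv (\<lambda>x. exp (f x)) v = (\<lambda>x. exp (f x) * dir_deriv f v x)" for v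
    by (intro ext dir_deriv_eq)
  moreover have "Ck k (\<lambda>x. exp (f x) * dir_deriv f v x)" for v
    using Suc.prems by (intro Ck_mult Suc.IH Ck_SucD[OF Suc.prems]) auto
  moreover have "(\<lambda>x. exp (f x)) differentiable (at x)" for x
    using * differentiable_def by blast
  ultimately show ?case by simp
qed

lemma dir_deriv_linear: "f differentiable (at x) \<Longrightarrow> linear (\<lambda>v. dir_deriv f v x)"
  using linear_frechet_derivative by blast

section \<open>Symmetry of second derivatives\<close>

text \<open>The mean value theorem for the restriction of \<open>f\<close> to the line through
  \<open>x\<close> in direction \<open>v\<close>.\<close>

lemma increment_eq_dir_deriv:
  assumes f: "\<And>x. f differentiable (at x)" and "0 < h"
  obtains \<xi> where "0 < \<xi>" "\<xi> < h" "f (x + h *\<^sub>R v) - f x = h * dir_deriv f v (x + \<xi> *\<^sub>R v)"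
proof -
  have D: "((\<lambda>s. f (x + s *\<^sub>R v)) has_real_derivative dir_deriv f v (x + s *\<^sub>R v)) (at s)" for s
  proof -
    have "((\<lambda>s. x + s *\<^sub>R v) has_derivative (\<lambda>h. h *\<^sub>R v)) (at s)"
      by (auto intro!: derivative_eq_intros)
    from has_derivative_compose[OF this has_derivative_dir_deriv[OF f]]
    have "((\<lambda>s. f (x + s *\<^sub>R v)) has_derivative (\<lambda>h. dir_deriv f (h *\<^sub>R v) (x + s *\<^sub>R v))) (at s)" .
    moreover have "dir_deriv f (h *\<^sub>R v) (x + s *\<^sub>R v) = dir_deriv f v (x + s *\<^sub>R v) * h" for h
      using linear_scale[OF dir_deriv_linear[OF f]] by simp
    ultimately show ?thesis
      by (simp add: has_field_derivative_def)
  qed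
  from MVT2[OF \<open>0 < h\<close> D] show ?thesis
    using that by auto
qed

lemma second_difference_eq:
  assumes "Ck 2 f" "0 < h"
  obtains \<xi> \<eta> where "0 < \<xi>" "\<xi> < h" "0 < \<eta>" "\<eta> < h"
    "f (x + h *\<^sub>R v + h *\<^sub>R w) - f (x + h *\<^sub>R v) - f (x + h *\<^sub>R w) + f x
      = h * h * dir_deriv (dir_deriv f w) v (x + \<xi> *\<^sub>R w + \<eta> *\<^sub>R v)"
proof -
  have f: "f differentiable (at y)" "dir_deriv f w differentiable (at y)" for y
    using assms by (auto simp: numeral_2_eq_2)
  \<comment> \<open>The increment of \<open>g\<close> along \<open>h *\<^sub>R w\<close> is the
    second difference. The mean value theorem, applied to \<open>g\<close> along \<open>w\<close>
    and then to \<open>dir_deriv f w\<close> along \<open>v\<close>, produces one factor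
    \<open>h\<close> each time.\<close>
  define g where "g y = f (y + h *\<^sub>R v) - f y" for y
  have g': "(g has_derivative (\<lambda>u. dir_deriv f u (y + h *\<^sub>R v) - dir_deriv f u y)) (at y)" for y
  proof -
    have "((\<lambda>y. y + h *\<^sub>R v) has_derivative (\<lambda>u. u)) (at y)"
      by (auto intro!: derivative_eq_intros)
    from has_derivative_compose[OF this has_derivative_dir_deriv[OF f(1)]]
    show ?thesis
      unfolding g_def by (intro has_derivative_diff has_derivative_dir_deriv f)
  qed
  then have "g differentiable (at y)" for y
    by (auto simp: differentiable_def)
  from increment_eq_dir_deriv[of g, OF this \<open>0 < h\<close>, of x w] obtain \<xi> where
    \<xi>: "0 < \<xi>" "\<xi> < h" "g (x + h *\<^sub>R w) - g x = h * dir_deriv g w (x + \<xi> *\<^sub>R w)" .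
  from increment_eq_dir_deriv[of "dir_deriv f w", OF f(2) \<open>0 < h\<close>, of "x + \<xi> *\<^sub>R w" v] obtain \<eta> where
    \<eta>: "0 < \<eta>" "\<eta> < h" "dir_deriv f w (x + \<xi> *\<^sub>R w + h *\<^sub>R v) - dir_deriv f w (x + \<xi> *\<^sub>R w)
       = h * dir_deriv (dir_deriv f w) v (x + \<xi> *\<^sub>R w + \<eta> *\<^sub>R v)" .
  have "g (x + h *\<^sub>R w) - g x = h * (h * dir_deriv (dir_deriv f w) v (x + \<xi> *\<^sub>R w + \<eta> *\<^sub>R v))"
    unfolding \<xi>(3) dir_deriv_eq[OF g'] \<eta>(3) ..
  then show ?thesis
    using that[OF \<xi>(1,2) \<eta>(1,2)] by (simp add: g_def algebra_simps)
qed

text \<open>The intermediate points are squeezed towards \<open>x\<close>, where the iterated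
  derivative is continuous.\<close>

lemma second_difference_tendsto:
  assumes "Ck 2 f"
  defines "h \<equiv> \<lambda>n. inverse (real (Suc n))"
  shows "(\<lambda>n. (f (x + h n *\<^sub>R v + h n *\<^sub>R w) - f (x + h n *\<^sub>R v) - f (x + h n *\<^sub>R w) + f x) / (h n * h n))
    \<longlonglongrightarrow> dir_deriv (dir_deriv f w) v x"
proof -
  have h: "0 < h n" for n
    by (simp add: h_def)
  have "\<exists>\<xi> \<eta>. 0 < \<xi> \<and> \<xi> < h n \<and> 0 < \<eta> \<and> \<eta> < h n \<and>
    f (x + h n *\<^sub>R v + h n *\<^sub>R w) - f (x + h n *\<^sub>R v) - f (x + h n *\<^sub>R w) + f x
      = h n * h n * dir_deriv (dir_deriv f w) v (x + \<xi> *\<^sub>R w + \<eta> *\<^sub>R v)" for n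
    using second_difference_eq[OF assms(1) h] by metis
  then obtain \<xi> \<eta> where *: "0 < \<xi> n" "\<xi> n < h n" "0 < \<eta> n" "\<eta> n < h n"
    "f (x + h n *\<^sub>R v + h n *\<^sub>R w) - f (x + h n *\<^sub>R v) - f (x + h n *\<^sub>R w) + f x
      = h n * h n * dir_deriv (dir_deriv f w) v (x + \<xi> n *\<^sub>R w + \<eta> n *\<^sub>R v)" for n
    by metis
  have h0: "h \<longlonglongrightarrow> 0"
    unfolding h_def by (rule LIMSEQ_inverse_real_of_nat)
  have "\<xi> \<longlonglongrightarrow> 0" "\<eta> \<longlonglongrightarrow> 0"
    by (rule tendsto_sandwich[OF _ _ tendsto_const h0]; simp add: * less_imp_le)+
  then have "(\<lambda>n. x + \<xi> n *\<^sub>R w + \<eta> n *\<^sub>R v) \<longlonglongrightarrow> x + 0 *\<^sub>R w + 0 *\<^sub>R v"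
    by (intro tendsto_intros)
  moreover have "isCont (dir_deriv (dir_deriv f w) v) x"
    using assms(1) by (auto simp: numeral_2_eq_2 continuous_on_eq_continuous_at)
  ultimately have "(\<lambda>n. dir_deriv (dir_deriv f w) v (x + \<xi> n *\<^sub>R w + \<eta> n *\<^sub>R v))
      \<longlonglongrightarrow> dir_deriv (dir_deriv f w) v x"
    using isCont_tendsto_compose by fastforce
  moreover have "h n \<noteq> 0" for n
    using h[of n] by simp
  ultimately show ?thesis
    by (simp add: *(5))
qed

text \<open>The second difference is symmetric in \<open>v\<close> and \<open>w\<close>, so both
  iterated derivatives are limits of the same sequence.\<close>

lemma dir_deriv_commute:
  assumes "Ck 2 f"
  shows "dir_deriv (dir_deriv f v) w x = dir_deriv (dir_deriv f w) v x"
  by (rule LIMSEQ_unique[OF second_difference_tendsto[OF assms, of x w v]])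
     (use second_difference_tendsto[OF assms, of x v w] in \<open>simp add: algebra_simps\<close>)

section \<open>Compactly supported functions\<close>

text \<open>The complement of \<open>S\<close> is open, so \<open>f\<close> vanishes on a whole
  neighbourhood of \<open>x\<close>.\<close>

lemma dir_deriv_eq_0_outside:
  assumes "closed S" "\<And>x. x \<notin> S \<Longrightarrow> f x = 0" "x \<notin> S"
  shows "dir_deriv f v x = 0"
proof -
  have "(f has_derivative (\<lambda>_. 0)) (at x)"
    by (rule has_derivative_transform_within_open[OF has_derivative_const[of 0], of "- S"])
       (use assms in auto)
  then show ?thesis by (rule dir_deriv_eq)
qed

lemma integrable_compact_support:
  fixes f :: "'a::euclidean_space \<Rightarrow> real"
  assumes "continuous_on UNIV f" "compact S" "\<And>x. x \<notin> S \<Longrightarrow> f x = 0"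
  shows "integrable lborel f"
proof -
  have "integrable lborel (\<lambda>x. indicator S x *\<^sub>R f x)"
    using assms by (intro borel_integrable_compact) (auto intro: continuous_on_subset)
  moreover have "(\<lambda>x. indicator S x *\<^sub>R f x) = f"
    using assms(3) by (auto simp: indicator_def fun_eq_iff)
  ultimately show ?thesis by simp
qed

text \<open>The integral of a difference quotient vanishes by translation invariance.\<close>

lemma integral_dir_deriv_eq_0:
  fixes f :: "'a::euclidean_space \<Rightarrow> real"
  assumes "Ck 1 f" "compact S" "\<And>x. x \<notin> S \<Longrightarrow> f x = 0"
  shows "(LINT x|lborel. dir_deriv f v x) = 0"
proof -
  have f: "\<And>x. f differentiable (at x)" "continuous_on UNIV (dir_deriv f v)"
    using assms(1) by auto
  have cont: "continuous_on UNIV f"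
    using assms(1) by (rule Ck_imp_continuous)
  have "bounded (dir_deriv f v ` S)"
    by (intro compact_imp_bounded compact_continuous_image assms continuous_on_subset[OF f(2)]) auto
  then obtain B where B: "0 < B" "\<And>x. x \<in> S \<Longrightarrow> \<bar>dir_deriv f v x\<bar> \<le> B"
    unfolding bounded_pos by auto
  have B': "\<bar>dir_deriv f v x\<bar> \<le> B" for x
    using B dir_deriv_eq_0_outside[OF compact_imp_closed[OF assms(2)] assms(3)]
    by (cases "x \<in> S") auto
  \<comment> \<open>\<open>T\<close> is \<open>S\<close> swept backwards along \<open>v\<close> for
    times in \<open>[0, 1]\<close>. As the steps \<open>h n\<close> are at most 1, this one compact
    set supports all the difference quotients.\<close>
  define T where "T = (\<lambda>(y, t). y - t *\<^sub>R v) ` (S \<times> {0..1})"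
  have T: "compact T"
    unfolding T_def case_prod_unfold
    by (intro compact_continuous_image compact_Times assms compact_Icc continuous_intros)
  have S_T: "x \<in> T" if "x + t *\<^sub>R v \<in> S" "0 \<le> t" "t \<le> 1" for x t
    unfolding T_def using that by (intro image_eqI[of _ _ "(x + t *\<^sub>R v, t)"]) auto
  define h where "h n = inverse (real (Suc n))" for n
  have h: "0 < h n" "h n \<le> 1" for n
    by (auto simp: h_def inverse_le_1_iff)
  define s where "s n x = (f (x + h n *\<^sub>R v) - f x) / h n" for n x
  have int: "integrable lborel f"
    using integrable_compact_support[OF cont] assms by blast
  have shift: "integrable lborel (\<lambda>x. f (x + c))" "(LINT x|lborel. f (x + c)) = (LINT x|lborel. f x)" for c
  proof -
    have f: "f \<in> borel_measurable borel"
      using cont by (rule borel_measurable_continuous_onI)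
    have "integrable (distr lborel borel ((+) c)) f"
      using int by (simp add: lborel_distr_plus)
    then show "integrable lborel (\<lambda>x. f (x + c))"
      using f by (subst (asm) integrable_distr_eq) (auto simp: add.commute)
    have "(LINT x|distr lborel borel ((+) c). f x) = (LINT x|lborel. f (c + x))"
      using f by (intro integral_distr) auto
    then show "(LINT x|lborel. f (x + c)) = (LINT x|lborel. f x)"
      by (simp add: lborel_distr_plus add.commute)
  qed
  have s0: "(LINT x|lborel. s n x) = 0" for n
    using int shift unfolding s_def by simp
  have "(\<lambda>n. LINT x|lborel. s n x) \<longlonglongrightarrow> (LINT x|lborel. dir_deriv f v x)"
  proof (rule integral_dominated_convergence[where w = "\<lambda>x. indicator T x *\<^sub>R B"])
    show "dir_deriv f v \<in> borel_measurable lborel"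
      using borel_measurable_continuous_onI[OF f(2)] by simp
    show "s n \<in> borel_measurable lborel" for n
      unfolding s_def using int shift by (intro borel_measurable_divide borel_measurable_diff) auto
    show "integrable lborel (\<lambda>x. indicator T x *\<^sub>R B)"
      by (intro borel_integrable_compact T continuous_on_const)
    \<comment> \<open>On \<open>T\<close> the quotient is a value of the derivative by the mean
      value theorem, hence bounded by \<open>B\<close>; off \<open>T\<close> both function values in
      it vanish.\<close>
    have bound: "norm (s n x) \<le> indicator T x *\<^sub>R B" for n x
    proof (cases "x \<in> T")
      case True
      from increment_eq_dir_deriv[of f, OF f(1) h(1)[of n], of x v] obtain \<xi> where
        "f (x + h n *\<^sub>R v) - f x = h n * dir_deriv f v (x + \<xi> *\<^sub>R v)" by blast
      then have "s n x = dir_deriv f v (x + \<xi> *\<^sub>R v)"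
        using h(1)[of n] by (simp add: s_def)
      then show ?thesis
        using B' True by simp
    next
      case False
      then have "f (x + h n *\<^sub>R v) = 0" "f x = 0"
        using S_T[of x "h n"] S_T[of x 0] h[of n] assms(3) by auto
      then show ?thesis using False by (simp add: s_def)
    qed
    then show "AE x in lborel. norm (s n x) \<le> indicator T x *\<^sub>R B" for n
      by simp
    have "(\<lambda>n. s n x) \<longlonglongrightarrow> dir_deriv f v x" for x
    proof -
      have "\<exists>\<xi>. 0 < \<xi> \<and> \<xi> < h n \<and> s n x = dir_deriv f v (x + \<xi> *\<^sub>R v)" for n
        using increment_eq_dir_deriv[of f, OF f(1) h(1)[of n], of x v] h(1)[of n]
        unfolding s_def by (metis less_irrefl nonzero_mult_div_cancel_left)
      then obtain \<xi> where \<xi>: "0 < \<xi> n" "\<xi> n < h n" "s n x = dir_deriv f v (x + \<xi> n *\<^sub>R v)" for n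
        by metis
      have h0: "h \<longlonglongrightarrow> 0"
        unfolding h_def by (rule LIMSEQ_inverse_real_of_nat)
      have "\<xi> \<longlonglongrightarrow> 0"
        by (rule tendsto_sandwich[OF _ _ tendsto_const h0]; simp add: \<xi> less_imp_le)
      then have "(\<lambda>n. x + \<xi> n *\<^sub>R v) \<longlonglongrightarrow> x + 0 *\<^sub>R v"
        by (intro tendsto_intros)
      then show ?thesis
        unfolding \<xi>(3) using f(2)
        by (intro isCont_tendsto_compose[of _ "dir_deriv f v"])
           (simp_all add: continuous_on_eq_continuous_at)
    qed
    then show "AE x in lborel. (\<lambda>n. s n x) \<longlonglongrightarrow> dir_deriv f v x"
      by simp
  qed
  then show ?thesis
    by (simp add: s0 LIMSEQ_const_iff)
qed

section \<open>Gradients and divergences\<close>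

text \<open>\<open>grad\<close> is a definite description, so existence and uniqueness are both
  required. The witness \<open>D\<close> collects the derivatives along the basis vectors.\<close>

lemma GDERIV_grad:
  assumes "f differentiable (at x)"
  shows "GDERIV f x :> grad f x"
proof -
  define D where "D = (\<Sum>b\<in>Basis. dir_deriv f b x *\<^sub>R b)"
  have "dir_deriv f h x = h \<bullet> D" for h
    unfolding D_def using Linear_Algebra.linear_componentwise[OF dir_deriv_linear[OF assms], of h 1]
    by (simp add: inner_sum_right mult.commute)
  then have D: "GDERIV f x :> D"
    using has_derivative_dir_deriv[OF assms] by (simp add: gderiv_def)
  moreover have "E = D" if "GDERIV f x :> E" for E
  proof -
    have "h \<bullet> E = h \<bullet> D" for h
      using that D unfolding gderiv_def by (metis dir_deriv_eq)
    then show ?thesis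
      by (metis inner_commute vector_eq_rdot)
  qed
  ultimately show ?thesis
    unfolding grad_def by (rule theI)
qed

lemma inner_grad: "f differentiable (at x) \<Longrightarrow> v \<bullet> grad f x = dir_deriv f v x"
  using GDERIV_grad dir_deriv_eq unfolding gderiv_def by fastforce

lemma grad_eqI:
  assumes "f differentiable (at x)" "\<And>v. dir_deriv f v x = v \<bullet> D"
  shows "grad f x = D"
  using inner_grad[OF assms(1)] assms(2) by (metis vector_eq_rdot inner_commute)

text \<open>Moving \<open>A\<close> across the inner product to its adjoint \<open>A'\<close> turns
  each coordinate into a directional derivative. Vector fields built from gradients thereby reduce
  to scalar functions covered by the \<open>Ck\<close> calculus.\<close>

lemma linear_grad_expand:
  assumes "f differentiable (at x)" "\<And>u v. A u \<bullet> v = u \<bullet> A' v"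
  shows "A (grad f x) = (\<Sum>b\<in>Basis. dir_deriv f (A' b) x *\<^sub>R b)"
proof -
  have "A (grad f x) \<bullet> b = dir_deriv f (A' b) x" for b
    using inner_grad[OF assms(1)] by (metis assms(2) inner_commute)
  then show ?thesis
    by (metis (no_types, lifting) euclidean_representation sum.cong)
qed

lemma has_derivative_linear_grad:
  assumes "Ck 2 f" "\<And>u v. A u \<bullet> v = u \<bullet> A' v"
  shows "((\<lambda>y. A (grad f y)) has_derivative
    (\<lambda>v. \<Sum>b\<in>Basis. dir_deriv (dir_deriv f (A' b)) v x *\<^sub>R b)) (at x)"
proof -
  have f: "f differentiable (at y)" "dir_deriv f w differentiable (at y)" for y w
    using assms(1) by (auto simp: numeral_2_eq_2)
  show ?thesis
    unfolding linear_grad_expand[of f, OF f(1) assms(2)]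
    by (intro has_derivative_sum has_derivative_scaleR_left has_derivative_dir_deriv f)
qed

section \<open>Divergences of linear images of gradients\<close>

lemma divg_linear_grad:
  assumes "Ck 2 f" "\<And>u v. A u \<bullet> v = u \<bullet> A' v"
  shows "divg (\<lambda>y. A (grad f y)) x = (\<Sum>b\<in>Basis. dir_deriv (dir_deriv f (A' b)) b x)"
  unfolding divg_def frechet_derivative_at[OF has_derivative_linear_grad[OF assms], symmetric]
  by (simp add: inner_sum_left inner_Basis sum.delta if_distrib cong: if_cong)

text \<open>This is the trace of a symmetric form against a skew map. After expanding
  \<open>J b\<close> in the basis, exchanging the two indices preserves the form and flips the sign
  of the coefficients, so the sum equals its own negative.\<close>

lemma sum_skew_symmetric_eq_0:
  fixes B :: "'a::euclidean_space \<Rightarrow> 'a \<Rightarrow> real"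
  assumes "\<And>u. linear (B u)" "\<And>u v. B u v = B v u" "\<And>u v. J u \<bullet> v = - (u \<bullet> J v)"
  shows "(\<Sum>b\<in>Basis. B b (J b)) = 0"
proof -
  have *: "B b (J b) = (\<Sum>c\<in>Basis. (J b \<bullet> c) * B b c)" for b
    using Linear_Algebra.linear_componentwise[OF assms(1), of b "J b" 1] by simp
  define s where "s = (\<Sum>b\<in>Basis. \<Sum>c\<in>Basis. (J b \<bullet> c) * B b c)"
  have "s = (\<Sum>c\<in>Basis. \<Sum>b\<in>Basis. (J b \<bullet> c) * B b c)"
    unfolding s_def by (rule sum.swap)
  also have "\<dots> = (\<Sum>c\<in>Basis. \<Sum>b\<in>Basis. - ((J c \<bullet> b) * B c b))"
    using assms(2,3) by (intro sum.cong refl) (metis inner_commute mult_minus_left)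
  also have "\<dots> = - s"
    by (simp add: s_def sum_negf)
  finally show ?thesis
    by (simp add: * flip: s_def)
qed

text \<open>Linearity in the outer direction is that of the derivative; symmetry of second
  derivatives transfers it to the inner one.\<close>

lemma linear_dir_deriv_dir_deriv:
  assumes "Ck 2 f"
  shows "linear (\<lambda>u. dir_deriv (dir_deriv f u) v x)" "linear (\<lambda>v. dir_deriv (dir_deriv f u) v x)"
proof -
  have f: "f differentiable (at y)" "dir_deriv f w differentiable (at y)" for y w
    using assms(1) by (auto simp: numeral_2_eq_2)
  show *: "linear (\<lambda>v. dir_deriv (dir_deriv f u) v x)" for u
    by (rule dir_deriv_linear) (rule f)
  show "linear (\<lambda>u. dir_deriv (dir_deriv f u) v x)"
    using *[of v] unfolding dir_deriv_commute[OF assms, of v] .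
qed

text \<open>The adjoint of \<open>J\<close> is \<open>-J\<close>, so the divergence is minus the
  trace of the Hessian against a skew map.\<close>

lemma divg_skew_grad:
  assumes "Ck 2 f" "\<And>u v. J u \<bullet> v = - (u \<bullet> J v)"
  shows "divg (\<lambda>y. J (grad f y)) x = 0"
proof -
  have "divg (\<lambda>y. J (grad f y)) x = (\<Sum>b\<in>Basis. dir_deriv (dir_deriv f (- J b)) b x)"
    by (rule divg_linear_grad) (use assms in auto)
  also have "\<dots> = (\<Sum>b\<in>Basis. - dir_deriv (dir_deriv f b) (J b) x)"
    by (simp add: linear_neg[OF linear_dir_deriv_dir_deriv(1)[OF assms(1)]]
        dir_deriv_commute[OF assms(1), of "J _"])
  also have "\<dots> = 0"
    unfolding sum_negf neg_equal_0_iff_equal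
    by (intro sum_skew_symmetric_eq_0[where B = "\<lambda>u v. dir_deriv (dir_deriv f u) v x"]
        linear_dir_deriv_dir_deriv(2) dir_deriv_commute assms)
  finally show ?thesis .
qed

text \<open>The skew part contributes zero and can be inserted at will. With the directions
  \<open>K b - J b\<close> the diffusion term matches the advection term, so that the product rule
  can merge them.\<close>

lemma divg_selfadjoint_grad:
  assumes "Ck 2 f" "\<And>u v. K u \<bullet> v = u \<bullet> K v" "\<And>u v. J u \<bullet> v = - (u \<bullet> J v)"
  shows "divg (\<lambda>y. K (grad f y)) x = (\<Sum>b\<in>Basis. dir_deriv (dir_deriv f (K b - J b)) b x)"
proof -
  have "divg (\<lambda>y. J (grad f y)) x = (\<Sum>b\<in>Basis. dir_deriv (dir_deriv f (- J b)) b x)"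
    by (rule divg_linear_grad) (use assms in auto)
  then have "(\<Sum>b\<in>Basis. dir_deriv (dir_deriv f (J b)) b x) = 0"
    unfolding divg_skew_grad[OF assms(1,3)]
    by (simp add: linear_neg[OF linear_dir_deriv_dir_deriv(1)[OF assms(1)]] sum_negf)
  then show ?thesis
    unfolding divg_linear_grad[OF assms(1,2)]
    by (simp add: linear_diff[OF linear_dir_deriv_dir_deriv(1)[OF assms(1)]] sum_subtractf)
qed

section \<open>Slices of space-time functions and the weak formulation\<close>

lemma dir_deriv_slice:
  fixes f :: "'a::euclidean_space \<times> 'b::euclidean_space \<Rightarrow> real"
  assumes "f differentiable (at (t, z))"
  shows "(\<lambda>w. f (t, w)) differentiable (at z)"
    and "dir_deriv (\<lambda>w. f (t, w)) v z = dir_deriv f (0, v) (t, z)"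
proof -
  have "((\<lambda>w. (t, w)) has_derivative (\<lambda>v. (0, v))) (at z)"
    by (auto intro!: derivative_eq_intros)
  from has_derivative_compose[OF this has_derivative_dir_deriv[OF assms]]
  have *: "((\<lambda>w. f (t, w)) has_derivative (\<lambda>v. dir_deriv f (0, v) (t, z))) (at z)" .
  then show "(\<lambda>w. f (t, w)) differentiable (at z)"
    using differentiable_def by blast
  show "dir_deriv (\<lambda>w. f (t, w)) v z = dir_deriv f (0, v) (t, z)"
    using * by (rule dir_deriv_eq)
qed

lemma Ck_slice:
  fixes f :: "'a::euclidean_space \<times> 'b::euclidean_space \<Rightarrow> real"
  assumes "Ck k f"
  shows "Ck k (\<lambda>w. f (t, w))"
  using assms
proof (induction k arbitrary: f)
  case 0
  then show ?case
    using continuous_on_compose2[of UNIV f UNIV "\<lambda>w. (t, w)"]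
    by (simp add: continuous_on_Pair)
next
  case (Suc k)
  have "Ck k (\<lambda>w. dir_deriv f (0, v) (t, w))" for v
    by (rule Suc.IH[OF Ck_dir_deriv[OF Suc.prems]])
  then show ?case
    using Suc.prems dir_deriv_slice[of f] by simp
qed

lemma deriv_slice:
  fixes f :: "real \<times> 'b::euclidean_space \<Rightarrow> real"
  assumes "f differentiable (at (t, z))"
  shows "deriv (\<lambda>s. f (s, z)) t = dir_deriv f (1, 0) (t, z)"
proof -
  have "((\<lambda>s. (s, z)) has_derivative (\<lambda>h. (h, 0))) (at t)"
    by (auto intro!: derivative_eq_intros)
  from has_derivative_compose[OF this has_derivative_dir_deriv[OF assms]]
  have "((\<lambda>s. f (s, z)) has_derivative (\<lambda>h. dir_deriv f (h, 0) (t, z))) (at t)" .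
  moreover have "dir_deriv f (h, 0) (t, z) = dir_deriv f (1, 0) (t, z) * h" for h
    using linear_scale[OF dir_deriv_linear[OF assms], of h "(1, 0)"] by simp
  then have "(\<lambda>h. dir_deriv f (h, 0) (t, z)) = (*) (dir_deriv f (1, 0) (t, z))"
    by (rule ext)
  ultimately show ?thesis
    by (intro DERIV_imp_deriv) (simp only: has_field_derivative_def)
qed

text \<open>The flux enters already rewritten through \<open>grad \<rho>\<close>, so only the
  symmetry types of \<open>J\<close> and \<open>K\<close> matter here. Each integral identity comes
  from writing the integrand as a sum of directional derivatives of compactly supported
  \<open>Ck 1\<close> functions on space-time.\<close>

lemma stationary_weak_formulation:
  fixes \<rho> :: "'a::euclidean_space \<Rightarrow> real" and \<phi> :: "real \<times> 'a \<Rightarrow> real" and J K :: "'a \<Rightarrow> 'a"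
  assumes \<rho>: "Ck 1 \<rho>" and \<phi>: "\<And>k. Ck k \<phi>"
    and S: "compact S" "\<And>x. x \<notin> S \<Longrightarrow> \<phi> x = 0"
    and lin: "linear J" "linear K"
    and J: "\<And>u v. J u \<bullet> v = - (u \<bullet> J v)" and K: "\<And>u v. K u \<bullet> v = u \<bullet> K v"
  defines "time \<equiv> \<lambda>(t, z). \<rho> z * deriv (\<lambda>s. \<phi> (s, z)) t"
    and "advection \<equiv> \<lambda>(t, z). (K (grad \<rho> z) - J (grad \<rho> z)) \<bullet> grad (\<lambda>w. \<phi> (t, w)) z"
    and "diffusion \<equiv> \<lambda>(t, z). \<rho> z * divg (\<lambda>w. K (grad (\<lambda>v. \<phi> (t, v)) w)) z"
  shows "integrable lborel time" "integrable lborel advection" "integrable lborel diffusion"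
    and "(LINT x|lborel. time x) = 0"
    and "(LINT x|lborel. advection x) + (LINT x|lborel. diffusion x) = 0"
proof -
  have \<phi>_diff: "\<phi> differentiable (at x)" "dir_deriv \<phi> v differentiable (at x)" for x v
    by (rule Ck_differentiable[OF \<phi>], rule Ck_differentiable[OF Ck_dir_deriv[OF \<phi>]])
  have \<rho>_diff: "\<rho> differentiable (at z)" for z
    using \<rho> by simp
  have d\<rho>_cont: "continuous_on UNIV (dir_deriv \<rho> b)" for b
    using \<rho> by simp
  have d\<phi>: "Ck k (dir_deriv \<phi> v)" for k v
    by (rule Ck_dir_deriv[OF \<phi>])
  have dd\<phi>: "Ck k (dir_deriv (dir_deriv \<phi> v) w)" for k v w
    by (rule Ck_dir_deriv[OF d\<phi>])
  note S0 = dir_deriv_eq_0_outside[OF compact_imp_closed[OF S(1)]]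
  have d\<phi>0: "dir_deriv \<phi> v x = 0" if "x \<notin> S" for v x
    by (rule S0[OF S(2) that])
  then have dd\<phi>0: "dir_deriv (dir_deriv \<phi> v) w x = 0" if "x \<notin> S" for v w x
    by (intro S0[where f = "dir_deriv \<phi> v", OF _ that])
  have \<rho>_snd: "Ck 1 (\<lambda>x :: real \<times> 'a. \<rho> (snd x))"
    by (rule Ck_compose_linear[OF \<rho>]) (simp add: linear_snd)
  have \<rho>_cont: "continuous_on UNIV (\<lambda>x :: real \<times> 'a. dir_deriv \<rho> b (snd x))" for b
    by (rule continuous_on_compose2[OF d\<rho>_cont continuous_on_snd[OF continuous_on_id]]) simp
  have \<rho>_snd_deriv:
    "((\<lambda>x. \<rho> (snd x)) has_derivative (\<lambda>h. dir_deriv \<rho> (snd h) (snd x))) (at x)" for x :: "real \<times> 'a"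
    by (rule has_derivative_compose[OF has_derivative_snd[OF has_derivative_ident] has_derivative_dir_deriv])
       (rule \<rho>_diff)
  have \<rho>d\<phi>: "dir_deriv (\<lambda>x. \<rho> (snd x) * dir_deriv \<phi> v x) (s, b) x
      = \<rho> (snd x) * dir_deriv (dir_deriv \<phi> v) (s, b) x + dir_deriv \<rho> b (snd x) * dir_deriv \<phi> v x" for v s b x
  proof -
    from dir_deriv_eq[OF has_derivative_mult[OF \<rho>_snd_deriv has_derivative_dir_deriv[OF \<phi>_diff(2)]], of v x "(s, b)"]
    show ?thesis by simp
  qed

  \<comment> \<open>\<open>\<rho>\<close> does not depend on time, so it can be pulled inside the
    time derivative.\<close>
  have time_eq: "time = (\<lambda>x. dir_deriv (\<lambda>x. \<rho> (snd x) * \<phi> x) (1, 0) x)"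
  proof
    fix x :: "real \<times> 'a"
    from dir_deriv_eq[OF has_derivative_mult[OF \<rho>_snd_deriv has_derivative_dir_deriv[OF \<phi>_diff(1)]], of x "(1, 0)"]
    show "time x = dir_deriv (\<lambda>x. \<rho> (snd x) * \<phi> x) (1, 0) x"
      using linear_0[OF dir_deriv_linear[OF \<rho>_diff]]
      by (simp add: time_def deriv_slice[OF \<phi>_diff(1)] split: prod.split)
  qed
  have \<rho>\<phi>: "Ck 1 (\<lambda>x. \<rho> (snd x) * \<phi> x)"
    by (intro Ck_mult \<rho>_snd \<phi>)
  have \<rho>\<phi>0: "\<rho> (snd x) * \<phi> x = 0" if "x \<notin> S" for x :: "real \<times> 'a"
    using S(2) that by simp
  show "integrable lborel time"
    unfolding time_eq
    by (rule integrable_compact_support[OF Ck_imp_continuous[where k = 0] S(1) S0[OF \<rho>\<phi>0]])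
       (rule Ck_dir_deriv[OF \<rho>\<phi>[unfolded One_nat_def]])
  show "(LINT x|lborel. time x) = 0"
    unfolding time_eq by (rule integral_dir_deriv_eq_0[OF \<rho>\<phi> S(1) \<rho>\<phi>0])

  \<comment> \<open>\<open>A\<close> maps \<open>grad \<rho>\<close> to the flux; its values
    \<open>A b\<close> are the directions in which the test function is differentiated.\<close>
  define A where "A v = K v - J v" for v
  have linA: "linear A"
    unfolding A_def using lin by (intro linear_compose_sub)
  have advection_eq: "advection = (\<lambda>x. \<Sum>b\<in>Basis. dir_deriv \<rho> b (snd x) * dir_deriv \<phi> (0, A b) x)"
  proof (intro ext, clarify)
    fix t z
    have "grad \<rho> z = (\<Sum>b\<in>Basis. dir_deriv \<rho> b z *\<^sub>R b)"
      using linear_grad_expand[OF \<rho>_diff, of "\<lambda>x. x" "\<lambda>x. x"] by simp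
    then have "A (grad \<rho> z) = (\<Sum>b\<in>Basis. dir_deriv \<rho> b z *\<^sub>R A b)"
      by (simp add: linear_sum[OF linA] linear_scale[OF linA])
    then have "advection (t, z) = (\<Sum>b\<in>Basis. dir_deriv \<rho> b z * (A b \<bullet> grad (\<lambda>w. \<phi> (t, w)) z))"
      by (simp add: advection_def inner_sum_left flip: A_def)
    then show "advection (t, z) = (\<Sum>b\<in>Basis. dir_deriv \<rho> b (snd (t, z)) * dir_deriv \<phi> (0, A b) (t, z))"
      by (simp add: inner_grad[OF dir_deriv_slice(1)[OF \<phi>_diff(1)]] dir_deriv_slice(2)[OF \<phi>_diff(1)])
  qed
  have diffusion_eq: "diffusion = (\<lambda>x. \<rho> (snd x) * (\<Sum>b\<in>Basis. dir_deriv (dir_deriv \<phi> (0, A b)) (0, b) x))"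
  proof (intro ext, clarify)
    fix t z
    have \<phi>t: "Ck 2 (\<lambda>w. \<phi> (t, w))"
      by (rule Ck_slice[OF \<phi>])
    have d\<phi>t: "dir_deriv (\<lambda>w. \<phi> (t, w)) v = (\<lambda>w. dir_deriv \<phi> (0, v) (t, w))" for v
      by (intro ext dir_deriv_slice(2) \<phi>_diff)
    have dd\<phi>t: "dir_deriv (dir_deriv (\<lambda>w. \<phi> (t, w)) v) u z = dir_deriv (dir_deriv \<phi> (0, v)) (0, u) (t, z)" for u v
      unfolding d\<phi>t by (rule dir_deriv_slice(2)[OF \<phi>_diff(2)])
    show "diffusion (t, z) = \<rho> (snd (t, z)) * (\<Sum>b\<in>Basis. dir_deriv (dir_deriv \<phi> (0, A b)) (0, b) (t, z))"
      by (simp add: diffusion_def divg_selfadjoint_grad[OF \<phi>t K J] dd\<phi>t A_def)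
  qed
  \<comment> \<open>Product rule along \<open>(0, b)\<close>: advection carries the derivative of
    \<open>\<rho>\<close>, diffusion the second derivative of \<open>\<phi>\<close>.\<close>
  have sum_eq: "advection x + diffusion x
      = (\<Sum>b\<in>Basis. dir_deriv (\<lambda>x. \<rho> (snd x) * dir_deriv \<phi> (0, A b) x) (0, b) x)" for x
    by (simp add: advection_eq diffusion_eq \<rho>d\<phi> sum.distrib sum_distrib_left)
  show int_adv: "integrable lborel advection"
    unfolding advection_eq
  proof (rule integrable_compact_support[OF _ S(1)])
    show "continuous_on UNIV (\<lambda>x. \<Sum>b\<in>Basis. dir_deriv \<rho> b (snd x) * dir_deriv \<phi> (0, A b) x)"
      by (intro continuous_on_sum continuous_on_mult \<rho>_cont Ck_imp_continuous[OF d\<phi>[of 0]])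
  qed (simp add: d\<phi>0)
  show int_diff: "integrable lborel diffusion"
    unfolding diffusion_eq
  proof (rule integrable_compact_support[OF _ S(1)])
    show "continuous_on UNIV (\<lambda>x. \<rho> (snd x) * (\<Sum>b\<in>Basis. dir_deriv (dir_deriv \<phi> (0, A b)) (0, b) x))"
      by (intro continuous_on_sum continuous_on_mult Ck_imp_continuous[OF \<rho>_snd]
          Ck_imp_continuous[OF dd\<phi>[of 0]])
  qed (simp add: dd\<phi>0)
  have C1: "Ck 1 (\<lambda>x. \<rho> (snd x) * dir_deriv \<phi> v x)" for v
    by (intro Ck_mult \<rho>_snd d\<phi>)
  have C10: "\<rho> (snd x) * dir_deriv \<phi> v x = 0" if "x \<notin> S" for v x
    using d\<phi>0 that by simp
  have int: "integrable lborel (dir_deriv (\<lambda>x. \<rho> (snd x) * dir_deriv \<phi> v x) w)" for v w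
    by (rule integrable_compact_support[OF Ck_imp_continuous[where k = 0] S(1) S0[OF C10]])
       (rule Ck_dir_deriv[OF C1[unfolded One_nat_def]])
  have "(LINT x|lborel. advection x) + (LINT x|lborel. diffusion x)
      = (LINT x|lborel. advection x + diffusion x)"
    by (rule Bochner_Integration.integral_add[OF int_adv int_diff, symmetric])
  also have "\<dots> = (\<Sum>b\<in>Basis. LINT x|lborel. dir_deriv (\<lambda>x. \<rho> (snd x) * dir_deriv \<phi> (0, A b) x) (0, b) x)"
    unfolding sum_eq by (rule Bochner_Integration.integral_sum[OF int])
  also have "\<dots> = 0"
    by (intro sum.neutral ballI integral_dir_deriv_eq_0[OF C1 S(1) C10])
  finally show "(LINT x|lborel. advection x) + (LINT x|lborel. diffusion x) = 0" .
qed

section \<open>The Gibbs density\<close>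

text \<open>The Gaussian factorizes over coordinates, which leaves a one-dimensional normal
  density.\<close>

lemma integrable_exp_neg_inner:
  fixes c :: real
  assumes "0 < c"
  shows "integrable lborel (\<lambda>x::'a::euclidean_space. exp (- (c * (x \<bullet> x))))"
proof -
  \<comment> \<open>Chosen so that the exponent of the normal density, minus
    \<open>x\<^sup>2 / (2 * \<sigma>\<^sup>2)\<close>, equals minus
    \<open>c * x\<^sup>2\<close>.\<close>
  define \<sigma> where "\<sigma> = sqrt (1 / (2 * c))"
  have \<sigma>: "\<sigma>\<^sup>2 = 1 / (2 * c)" "0 < \<sigma>"
    using assms by (simp_all add: \<sigma>_def)
  have "integrable lborel (\<lambda>x. sqrt (2 * pi * \<sigma>\<^sup>2) * normal_density 0 \<sigma> x)"
    using \<sigma> by (intro integrable_mult_right integrable_normal_density)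
  moreover have "sqrt (2 * pi * \<sigma>\<^sup>2) * normal_density 0 \<sigma> x = exp (- (c * x\<^sup>2))" for x
    using assms \<sigma> by (simp add: normal_density_def field_simps)
  ultimately have "integrable lborel (\<lambda>x::real. exp (- (c * x\<^sup>2)))"
    by simp
  then have fin: "(\<integral>\<^sup>+x. ennreal (exp (- (c * x\<^sup>2))) \<partial>lborel) < \<infinity>"
    by (simp add: integrable_iff_bounded)
  have "(\<integral>\<^sup>+x. ennreal (exp (- (c * (x \<bullet> x)))) \<partial>(lborel :: 'a measure))
      = (\<integral>\<^sup>+x. (\<Prod>b\<in>Basis. ennreal (exp (- (c * (x \<bullet> b)\<^sup>2)))) \<partial>(lborel :: 'a measure))"
    by (intro nn_integral_cong, subst euclidean_inner)
       (simp add: prod_ennreal power2_eq_square sum_distrib_left flip: exp_sum sum_negf)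
  also have "\<dots> = (\<Prod>b\<in>(Basis::'a set). \<integral>\<^sup>+x. ennreal (exp (- (c * x\<^sup>2))) \<partial>lborel)"
    by (rule nn_integral_lborel_prod) auto
  also have "\<dots> < \<infinity>"
    using fin by (simp add: less_top[symmetric] ennreal_prod_eq_top power_eq_top_ennreal)
  finally show ?thesis
    by (simp add: integrable_iff_bounded)
qed

lemma integrable_lborel_mult_Times:
  fixes f :: "'a::euclidean_space \<Rightarrow> real" and g :: "'b::euclidean_space \<Rightarrow> real"
  assumes f: "integrable lborel f" and g: "integrable lborel g"
  shows "integrable lborel (\<lambda>z. f (fst z) * g (snd z))"
proof -
  have [measurable]: "f \<in> borel_measurable borel" "g \<in> borel_measurable borel"
    using f g by auto
  have "integrable (lborel \<Otimes>\<^sub>M lborel) (\<lambda>z. f (fst z) * g (snd z))"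
  proof (rule lborel_pair.Fubini_integrable)
    show "integrable lborel (\<lambda>x. LINT y|lborel. norm (f (fst (x, y)) * g (snd (x, y))))"
      using f by (simp add: abs_mult)
    show "AE x in lborel. integrable lborel (\<lambda>y. f (fst (x, y)) * g (snd (x, y)))"
      using g by simp
  qed measurable
  then show ?thesis
    by (simp add: lborel_prod)
qed

text \<open>Substituting \<open>p = M x\<close> turns the form of the inverse into that of
  \<open>M\<close>, hence it is positive. Its minimum over the compact unit sphere serves as
  \<open>c\<close>, and homogeneity extends the bound to all \<open>p\<close>.\<close>

lemma sym_pos_definite_matrix_inv:
  assumes "sym_pos_definite M"
  obtains c where "0 < c" "\<And>p. c * (p \<bullet> p) \<le> p \<bullet> (matrix_inv M *v p)"
proof -
  have pos: "0 < x \<bullet> (M *v x)" if "x \<noteq> 0" for x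
    using assms that by (simp add: sym_pos_definite_def)
  have "inj ((*v) M)"
    using pos by (subst linear_injective_0) (force intro: matrix_vector_mul_linear)+
  then have "invertible M"
    by (simp add: invertible_left_inverse matrix_left_invertible_injective)
  then have inv: "M *v (matrix_inv M *v p) = p" for p
    unfolding matrix_inv_def invertible_def
    by (metis (mono_tags, lifting) matrix_vector_mul_assoc matrix_vector_mul_lid someI_ex)
  define q where "q p = p \<bullet> (matrix_inv M *v p)" for p
  have qpos: "0 < q p" if "p \<noteq> 0" for p
  proof -
    have "matrix_inv M *v p \<noteq> 0"
      using inv[of p] that by auto
    from pos[OF this] show ?thesis
      by (simp add: inv q_def inner_commute)
  qed
  have "continuous_on (sphere 0 1) q"
    unfolding q_def by (intro continuous_intros linear_continuous_on matrix_vector_mul_bounded_linear)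
  moreover have "sphere 0 1 \<noteq> ({} :: (real^'a) set)"
    using sphere_eq_empty by simp
  ultimately obtain u where u: "norm u = 1" "\<And>p. norm p = 1 \<Longrightarrow> q u \<le> q p"
    using continuous_attains_inf[of "sphere 0 1" q] by auto
  show ?thesis
  proof
    show "0 < q u"
      using u(1) by (intro qpos) auto
    show "q u * (p \<bullet> p) \<le> p \<bullet> (matrix_inv M *v p)" for p
    proof (cases "p = 0")
      case False
      have "q p = (norm p)\<^sup>2 * q ((1 / norm p) *\<^sub>R p)"
        using False by (simp add: q_def matrix_vector_mult_scaleR power2_eq_square)
      moreover have "q u \<le> q ((1 / norm p) *\<^sub>R p)"
        using False by (intro u) simp
      ultimately have "(norm p)\<^sup>2 * q u \<le> q p"
        by (simp add: mult_left_mono)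
      then show ?thesis
        by (simp add: q_def power2_norm_eq_inner mult.commute)
    qed simp
  qed
qed

text \<open>In coordinates the kinetic energy is a finite sum of products of linear functionals of
  \<open>z\<close>.\<close>

lemma Ck_hamiltonian:
  assumes "Ck k \<Phi>"
  shows "Ck k (hamiltonian \<Phi> M)"
proof -
  have "linear (\<lambda>z::'a phase. snd z $ i)" for i
    by (simp add: linear_iff)
  moreover have "linear (\<lambda>z::'a phase. (matrix_inv M *v snd z) $ i)" for i
    by (simp add: linear_iff matrix_vector_right_distrib matrix_vector_mult_scaleR)
  ultimately show ?thesis
    unfolding hamiltonian_def[abs_def] inner_vec_def inner_real_def
    by (intro Ck_add Ck_mult Ck_const Ck_sum Ck_linear Ck_compose_linear[OF assms] linear_fst) auto
qed

lemma Ck_gibbs_density: "Ck k \<Phi> \<Longrightarrow> Ck k (gibbs_density \<Phi> M)"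
  unfolding gibbs_density_def[abs_def] minus_mult_commute
  using Ck_mult[OF Ck_const Ck_hamiltonian, of k \<Phi> "-1"]
  by (intro Ck_mult Ck_const Ck_exp) simp

lemma probability_density_gibbs_density:
  assumes "Ck 1 \<Phi>" and int\<Phi>: "integrable lborel (\<lambda>q. exp (- \<Phi> q))" and M: "sym_pos_definite M"
  shows "probability_density (gibbs_density \<Phi> M)"
proof -
  obtain c where c: "0 < c" "\<And>p. c * (p \<bullet> p) \<le> p \<bullet> (matrix_inv M *v p)"
    using sym_pos_definite_matrix_inv[OF M] by blast
  have "continuous_on UNIV (\<lambda>z. exp (- hamiltonian \<Phi> M z))"
    by (intro continuous_intros Ck_imp_continuous[OF Ck_hamiltonian[OF assms(1)]])
  then have meas: "(\<lambda>z. exp (- hamiltonian \<Phi> M z)) \<in> borel_measurable lborel"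
    by (simp add: borel_measurable_continuous_onI)
  \<comment> \<open>The kinetic energy is at least \<open>c / 2\<close> times the squared momentum,
    so a Gaussian in \<open>p\<close> times the integrable factor in \<open>q\<close> dominates the
    Gibbs weight.\<close>
  have "integrable lborel (\<lambda>z. exp (- \<Phi> (fst z)) * exp (- (c / 2 * (snd z \<bullet> snd z))))"
    using c(1) by (intro integrable_lborel_mult_Times[OF int\<Phi>] integrable_exp_neg_inner) simp
  then have int: "integrable lborel (\<lambda>z. exp (- hamiltonian \<Phi> M z))"
  proof (rule Bochner_Integration.integrable_bound[OF _ meas], intro AE_I2)
    fix z
    show "norm (exp (- hamiltonian \<Phi> M z)) \<le> norm (exp (- \<Phi> (fst z)) * exp (- (c / 2 * (snd z \<bullet> snd z))))"
      using c(2)[of "snd z"] by (simp add: hamiltonian_def flip: exp_add)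
  qed
  \<comment> \<open>A vanishing integral would force the strictly positive weight to be zero almost
    everywhere, making the whole space a null set.\<close>
  have "(LINT z|lborel. exp (- hamiltonian \<Phi> M z)) \<noteq> 0"
  proof
    assume "(LINT z|lborel. exp (- hamiltonian \<Phi> M z)) = 0"
    then have "AE z in lborel. exp (- hamiltonian \<Phi> M z) = 0"
      by (subst (asm) integral_nonneg_eq_0_iff_AE[OF int]) auto
    then have "AE z::'a phase in lborel. False"
      by simp
    then have "emeasure lborel (UNIV :: 'a phase set) = 0"
      by (simp add: AE_iff_measurable[OF _ refl])
    then show False by simp
  qed
  moreover have "0 \<le> (LINT z|lborel. exp (- hamiltonian \<Phi> M z))"
    by simp
  ultimately show ?thesis
    using int by (simp add: probability_density_def gibbs_density_def[abs_def])
qed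

lemma grad_gibbs_density:
  assumes "Ck 1 \<Phi>"
  shows "grad (gibbs_density \<Phi> M) z = - gibbs_density \<Phi> M z *\<^sub>R grad (hamiltonian \<Phi> M) z"
proof (rule grad_eqI)
  show "gibbs_density \<Phi> M differentiable (at z)"
    by (rule Ck_differentiable[OF Ck_gibbs_density[OF assms[unfolded One_nat_def]]])
  have H: "hamiltonian \<Phi> M differentiable (at z)"
    by (rule Ck_differentiable[OF Ck_hamiltonian[OF assms[unfolded One_nat_def]]])
  define Z where "Z = 1 / (LINT w|lborel. exp (- hamiltonian \<Phi> M w))"
  have gibbs: "gibbs_density \<Phi> M = (\<lambda>z. Z * exp (- hamiltonian \<Phi> M z))"
    by (simp add: gibbs_density_def[abs_def] Z_def)
  have "(gibbs_density \<Phi> M has_derivative (\<lambda>v. - gibbs_density \<Phi> M z * dir_deriv (hamiltonian \<Phi> M) v z)) (at z)"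
    unfolding gibbs
    by (auto intro!: derivative_eq_intros has_derivative_dir_deriv[OF H])
  then show "dir_deriv (gibbs_density \<Phi> M) v z = v \<bullet> (- gibbs_density \<Phi> M z *\<^sub>R grad (hamiltonian \<Phi> M) z)" for v
    by (simp add: dir_deriv_eq inner_grad[OF H])
qed

section \<open>Invariance\<close>

lemma linear_Jmult: "linear (Jmult C)"
  by (rule linearI)
     (simp_all add: Jmult_def block_mult_def matrix_vector_right_distrib matrix_vector_mult_scaleR)

lemma linear_Kmult: "linear (Kmult K1 K2)"
  by (rule linearI)
     (simp_all add: Kmult_def block_mult_def matrix_vector_right_distrib matrix_vector_mult_scaleR)

lemma inner_matrix_mult_symmetric:
  fixes A :: "real^'n^'n"
  shows "transpose A = A \<Longrightarrow> (A *v u) \<bullet> v = u \<bullet> (A *v v)"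
  by (metis dot_lmul_matrix transpose_matrix_vector)

lemma matrix_vector_mult_uminus_left: "(- A) *v x = - (A *v (x :: real^'n))"
  by (simp add: matrix_vector_mult_def vec_eq_iff sum_negf)

text \<open>The off-diagonal blocks are \<open>C\<close> and \<open>-C\<close>; symmetry of
  \<open>C\<close> makes each minus the transpose of the other.\<close>

lemma Jmult_skew: "transpose C = C \<Longrightarrow> Jmult C u \<bullet> v = - (u \<bullet> Jmult C v)"
  by (simp add: Jmult_def block_mult_def inner_prod_def inner_matrix_mult_symmetric
      matrix_vector_mult_uminus_left)

lemma Kmult_selfadjoint:
  "transpose K1 = K1 \<Longrightarrow> transpose K2 = K2 \<Longrightarrow> Kmult K1 K2 u \<bullet> v = u \<bullet> Kmult K1 K2 v"
  by (simp add: Kmult_def block_mult_def inner_prod_def inner_matrix_mult_symmetric)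

text \<open>The fixed-point equation for \<open>\<pi>\<close> expresses the self-consistency of the
  Gibbs density. \<open>Laws\<close> collects the laws on which the matrix assumptions are
  imposed.\<close>

theorem proposition1p1:
  fixes \<Phi> :: "real^'n::finite \<Rightarrow> real"
    and C K1 K2 M :: "'n phase measure \<Rightarrow> real^'n^'n"
    and Laws :: "'n phase measure set"
    and \<pi> :: "'n phase \<Rightarrow> real"
  assumes "Ck 1 \<Phi>"
    and "integrable lborel (\<lambda>q. exp (- \<Phi> q))"
    and "\<And>\<mu>. \<mu> \<in> Laws \<Longrightarrow> sym_nonneg_definite (K1 \<mu>)"
    and "\<And>\<mu>. \<mu> \<in> Laws \<Longrightarrow> sym_nonneg_definite (K2 \<mu>)"
    and "\<And>\<mu>. \<mu> \<in> Laws \<Longrightarrow> sym_pos_definite (C \<mu>)"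
    and "\<And>\<mu>. \<mu> \<in> Laws \<Longrightarrow> sym_pos_definite (M \<mu>)"
    and "\<pi> = gibbs_density \<Phi> (M (law \<pi>))"
    and "law \<pi> \<in> Laws"
  shows "invariant_density C K1 K2 M \<Phi> \<pi>"
proof -
  \<comment> \<open>Along the constant curve the law never changes, so all matrices are frozen at
    \<open>\<mu>\<close> and the equation becomes linear.\<close>
  define \<mu> where "\<mu> = law \<pi>"
  define J where "J = Jmult (C \<mu>)"
  define K where "K = Kmult (K1 \<mu>) (K2 \<mu>)"
  have \<pi>: "\<pi> = gibbs_density \<Phi> (M \<mu>)" and "\<mu> \<in> Laws"
    using assms(7,8) by (simp_all add: \<mu>_def)
  note defs = assms(3-6)[OF \<open>\<mu> \<in> Laws\<close>]
  have J: "linear J" "J u \<bullet> v = - (u \<bullet> J v)" for u v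
    using defs by (simp_all add: J_def linear_Jmult Jmult_skew sym_pos_definite_def)
  have K: "linear K" "K u \<bullet> v = u \<bullet> K v" for u v
    using defs by (simp_all add: K_def linear_Kmult Kmult_selfadjoint sym_nonneg_definite_def)
  have prob: "probability_density \<pi>"
    unfolding \<pi> by (rule probability_density_gibbs_density[OF assms(1,2) defs(4)])
  have H: "hamiltonian \<Phi> (M \<mu>) differentiable (at z)" for z
    by (rule Ck_differentiable[OF Ck_hamiltonian[OF assms(1)[unfolded One_nat_def]]])
  have flux: "\<pi> z *\<^sub>R drift C K1 K2 M \<Phi> \<mu> z = K (grad \<pi> z) - J (grad \<pi> z)" for z
    unfolding \<pi> grad_gibbs_density[OF assms(1)] linear_scale[OF J(1)] linear_scale[OF K(1)]
    by (simp add: drift_def scaleR_diff_right flip: J_def K_def)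

  have "fokker_planck_distributional C K1 K2 M \<Phi> (\<lambda>t. \<pi>)"
    unfolding fokker_planck_distributional_def Let_def \<mu>_def[symmetric] K_def[symmetric] flux
  proof (intro conjI allI impI prob H)
    fix \<phi> :: "real \<times> 'n phase \<Rightarrow> real"
    assume "test_function ({0<..} \<times> UNIV) \<phi>"
    then have \<phi>: "\<And>k. Ck k \<phi>" "compact (closure (support_on UNIV \<phi>))"
      by (simp_all add: test_function_def)
    \<comment> \<open>The closed support is the compact set outside which the weak formulation needs
      \<open>\<phi>\<close> to vanish.\<close>
    have supp: "\<phi> x = 0" if "x \<notin> closure (support_on UNIV \<phi>)" for x
      using that closure_subset[of "support_on UNIV \<phi>"] by (auto simp: support_on_def)
    have "Ck 1 \<pi>"
      unfolding \<pi> by (rule Ck_gibbs_density[OF assms(1)])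
    note weak = stationary_weak_formulation[OF this \<phi> supp J(1) K(1) J(2) K(2)]
    show "integrable lborel (\<lambda>(t, z). \<pi> z * deriv (\<lambda>s. \<phi> (s, z)) t)"
      and "integrable lborel (\<lambda>(t, z). (K (grad \<pi> z) - J (grad \<pi> z)) \<bullet> grad (\<lambda>w. \<phi> (t, w)) z)"
      and "integrable lborel (\<lambda>(t, z). \<pi> z * divg (\<lambda>w. K (grad (\<lambda>v. \<phi> (t, v)) w)) z)"
      and "- (LINT x|lborel. (case x of (t, z) \<Rightarrow> \<pi> z * deriv (\<lambda>s. \<phi> (s, z)) t))
        = (LINT x|lborel. (case x of (t, z) \<Rightarrow> (K (grad \<pi> z) - J (grad \<pi> z)) \<bullet> grad (\<lambda>w. \<phi> (t, w)) z))
        + (LINT x|lborel. (case x of (t, z) \<Rightarrow> \<pi> z * divg (\<lambda>w. K (grad (\<lambda>v. \<phi> (t, v)) w)) z))"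
      using weak by simp_all
  qed
  moreover have "fokker_planck_classical C K1 K2 M \<Phi> (\<lambda>t. \<pi>)" if "Ck 2 \<Phi>"
    unfolding fokker_planck_classical_def Let_def \<mu>_def[symmetric] K_def[symmetric] flux
  proof (intro conjI allI impI prob H)
    fix t z
    have \<pi>2: "Ck 2 \<pi>"
      unfolding \<pi> by (rule Ck_gibbs_density[OF that])
    then show "\<pi> differentiable (at z)"
      unfolding numeral_2_eq_2 by (rule Ck_differentiable)
    \<comment> \<open>The adjoint of \<open>K - J\<close> is \<open>K + J\<close>, since
      \<open>J\<close> changes sign.\<close>
    have KJ: "(K u - J u) \<bullet> v = u \<bullet> (K v + J v)" for u v
      by (simp add: J K inner_diff_left inner_add_right)
    show "(\<lambda>z. K (grad \<pi> z) - J (grad \<pi> z)) differentiable (at z)"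
      using has_derivative_linear_grad[OF \<pi>2, of "\<lambda>u. K u - J u", OF KJ] differentiable_def by blast
    show "(\<lambda>z. K (grad \<pi> z)) differentiable (at z)"
      using has_derivative_linear_grad[OF \<pi>2 K(2)] differentiable_def by blast
    \<comment> \<open>Taking \<open>-J\<close> as the skew map inserts the directions
      \<open>K b + J b\<close> into the divergence of the diffusive flux, exactly those of the
      advective one. The two then cancel, matching the zero time derivative.\<close>
    have "divg (\<lambda>z. K (grad \<pi> z) - J (grad \<pi> z)) z = divg (\<lambda>z. K (grad \<pi> z)) z"
      using divg_linear_grad[OF \<pi>2, of "\<lambda>u. K u - J u", OF KJ]
        divg_selfadjoint_grad[OF \<pi>2 K(2), of "\<lambda>u. - J u"] J(2) by simp
    then show "((\<lambda>s. \<pi> z) has_real_derivative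
        - divg (\<lambda>z. K (grad \<pi> z) - J (grad \<pi> z)) z + divg (\<lambda>z. K (grad \<pi> z)) z) (at t)"
      by simp
  qed
  ultimately show ?thesis
    by (simp add: invariant_density_def)
qed

end
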